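(* Let $\Gamma$ be a smooth closed convex plane bicycle curve. If the rotation number of $\Gamma$ equals $1/3$, then $\Gamma$ is a circle.
   Context: A closed smooth convex plane curve $\Gamma$ of perimeter length $2\pi$ (the normalization used throughout), parameterized by arc length as $\Gamma:\mathbf{R}/2\pi\mathbf{Z}\to\mathbf{R}^2$, is a bicycle curve with rotation number $\rho\in(0,1)$ if the distance $|\Gamma(x+2\pi\rho)-\Gamma(x)|$ does not depend on $x$. *)

theory Defs
  imports "HOL-Analysis.Analysis"
begin

text \<open>A curve \<open>\<real>/2\<pi>\<int> \<rightarrow> \<real>\<^sup>2\<close> is represented by its \<open>2\<pi>\<close>-periodic lift to the real line.\<close>

definition iter_deriv :: "nat \<Rightarrow> (real \<Rightarrow> 'a::real_normed_vector) \<Rightarrow> real \<Rightarrow> 'a" where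
  "iter_deriv n \<gamma> = ((\<lambda>f t. vector_derivative f (at t)) ^^ n) \<gamma>"

definition smooth_curve :: "(real \<Rightarrow> 'a::real_normed_vector) \<Rightarrow> bool" where
  "smooth_curve \<gamma> \<longleftrightarrow> (\<forall>n. iter_deriv n \<gamma> differentiable_on UNIV)"

definition closed_curve_2pi :: "(real \<Rightarrow> 'a) \<Rightarrow> bool" where
  "closed_curve_2pi \<gamma> \<longleftrightarrow> (\<forall>x. \<gamma> (x + 2 * pi) = \<gamma> x)"

text \<open>Together with simplicity and period \<open>2\<pi>\<close>, unit speed makes the perimeter equal to \<open>2\<pi>\<close>.\<close>

definition arc_length_param :: "(real \<Rightarrow> 'a::real_normed_vector) \<Rightarrow> bool" where
  "arc_length_param \<gamma> \<longleftrightarrow> (\<forall>t. norm (vector_derivative \<gamma> (at t)) = 1)"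

text \<open>
  A convex curve is a simple closed curve bounding a convex region. Straight pieces are allowed,
  that is, convexity is not required to be strict.
\<close>

definition convex_curve :: "(real \<Rightarrow> real ^ 2) \<Rightarrow> bool" where
  "convex_curve \<gamma> \<longleftrightarrow> inj_on \<gamma> {0..<2 * pi} \<and>
     (\<exists>K. compact K \<and> convex K \<and> interior K \<noteq> {} \<and> frontier K = range \<gamma>)"

definition smooth_closed_convex_curve :: "(real \<Rightarrow> real ^ 2) \<Rightarrow> bool" where
  "smooth_closed_convex_curve \<gamma> \<longleftrightarrow>
     closed_curve_2pi \<gamma> \<and> smooth_curve \<gamma> \<and> arc_length_param \<gamma> \<and> convex_curve \<gamma>"

definition bicycle_curve :: "(real \<Rightarrow> real ^ 2) \<Rightarrow> real \<Rightarrow> bool" where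
  "bicycle_curve \<gamma> \<rho> \<longleftrightarrow> smooth_closed_convex_curve \<gamma> \<and> 0 < \<rho> \<and> \<rho> < 1 \<and>
     (\<exists>d. \<forall>x. dist (\<gamma> (x + 2 * pi * \<rho>)) (\<gamma> x) = d)"

definition is_circle :: "(real ^ 2) set \<Rightarrow> bool" where
  "is_circle S \<longleftrightarrow> (\<exists>c r. r > 0 \<and> S = sphere c r)"

end

theory Submission
  imports Defs
begin

text \<open>
  The points \<open>\<Gamma>(x)\<close>, \<open>\<Gamma>(x + 2\<pi>/3)\<close>, \<open>\<Gamma>(x + 4\<pi>/3)\<close> span an equilateral triangle of constant side
  that moves rigidly, its three vertices having equal speed. The velocities of the vertices,
  relative to the velocity \<open>m\<close> of the centre, are the radius vectors rotated by a right angle and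
  scaled by a common angular velocity \<open>s\<close>. Equality of the three speeds forces \<open>s = 0\<close> or \<open>m = 0\<close>,
  so the speed of a vertex relative to the centre is \<open>0\<close> or \<open>1\<close>, and by continuity it is
  the same at all times. If it is \<open>0\<close>, then \<open>\<Gamma>(x + 2\<pi>/3) - \<Gamma>(x)\<close> is constant, hence zero by
  periodicity, which contradicts simplicity. If it is \<open>1\<close>, then the centre is at rest and \<open>\<Gamma>\<close> lies
  on a circle; being the frontier of a convex body, it is the whole circle.
\<close>

definition rot90 :: "real ^ 2 \<Rightarrow> real ^ 2" where
  "rot90 v = vector [- v $ 2, v $ 1]"

lemma rot90_components [simp]: "rot90 v $ 1 = - v $ 2" "rot90 v $ 2 = v $ 1"
  by (simp_all add: rot90_def)

lemma inner_rot90_antisym: "v \<bullet> rot90 w = - (w \<bullet> rot90 v)"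
  by (simp add: inner_vec_def sum_2)

text \<open>Lagrange's identity in the plane: \<open>v \<bullet> rot90 w\<close> is, up to sign, the
  determinant of \<open>v\<close> and \<open>w\<close>.\<close>

lemma inner_rot90_Pythagoras: "(v \<bullet> w)\<^sup>2 + (v \<bullet> rot90 w)\<^sup>2 = (v \<bullet> v) * (w \<bullet> w)"
  by (simp add: inner_vec_def sum_2 power2_eq_square algebra_simps)

lemma orthogonal_eq_scaleR_rot90:
  assumes "v \<noteq> 0" "v \<bullet> w = 0"
  obtains s where "w = s *\<^sub>R rot90 v"
proof -
  have nz: "v \<bullet> v \<noteq> 0"
    using assms by simp
  \<comment> \<open>This expands \<open>w\<close> in the orthogonal basis \<open>v\<close>,
    \<open>rot90 v\<close>.\<close>
  have "(v \<bullet> v) *\<^sub>R w = (w \<bullet> rot90 v) *\<^sub>R rot90 v + (v \<bullet> w) *\<^sub>R v"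
    by (simp add: vec_eq_iff forall_2 inner_vec_def sum_2 algebra_simps)
  then have "w = ((w \<bullet> rot90 v) / (v \<bullet> v)) *\<^sub>R rot90 v"
    using nz assms by (simp add: eq_vector_fraction_iff)
  then show ?thesis ..
qed

text \<open>Here \<open>e\<close>, \<open>f\<close> are two radius vectors of the triangle,
  \<open>p\<close>, \<open>q\<close> their derivatives and \<open>m\<close> the velocity of the
  centre. The squared speed of the vertex with radius vector \<open>v\<close> is a constant plus
  \<open>2 * s * (m \<bullet> rot90 v)\<close>. Equal speeds make these three terms equal, and they
  sum to zero with the radius vectors, so all vanish.\<close>

lemma equal_speeds_imp_pure_translation_or_rotation:
  fixes e f p q m :: "real ^ 2"
  assumes pos: "r > 0"
    and ee: "e \<bullet> e = r" and ff: "f \<bullet> f = r" and ef: "e \<bullet> f = - r / 2"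
    and ep: "e \<bullet> p = 0" and fq: "f \<bullet> q = 0" and fp: "f \<bullet> p + e \<bullet> q = 0"
    and speeds: "norm (m + p) = norm (m + q)" "norm (m + p) = norm (m - p - q)"
  shows "p = 0 \<or> m = 0"
proof -
  have nz: "e \<noteq> 0" "f \<noteq> 0"
    using pos ee ff by auto
  obtain s where s: "p = s *\<^sub>R rot90 e"
    using orthogonal_eq_scaleR_rot90 nz(1) ep by blast
  obtain t where t: "q = t *\<^sub>R rot90 f"
    using orthogonal_eq_scaleR_rot90 nz(2) fq by blast
  \<comment> \<open>The determinant of \<open>e\<close> and \<open>f\<close>: its square is 3/4 of
    \<open>r * r\<close>, so the two are independent. It also turns \<open>fp\<close> into equality
    of the two angular velocities \<open>s\<close> and \<open>t\<close>.\<close>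
  define k where "k = f \<bullet> rot90 e"
  have "k\<^sup>2 = r * r - (r / 2)\<^sup>2"
    using inner_rot90_Pythagoras[of f e] ee ff ef by (simp add: k_def inner_commute)
  then have k: "k \<noteq> 0"
    using pos by (auto simp: power2_eq_square)
  have "(s - t) * k = 0"
    using fp inner_rot90_antisym[of e f] by (simp add: s t k_def algebra_simps)
  then have st: "t = s"
    using k by simp
  define g where "g = - e - f"
  have g: "g \<bullet> g = r"
    using ee ff ef by (simp add: g_def inner_diff inner_commute)
  have pq: "m - p - q = m + s *\<^sub>R rot90 g"
    by (simp add: s t st g_def vec_eq_iff forall_2 algebra_simps)
  have speed: "(norm (m + s *\<^sub>R rot90 v))\<^sup>2 = m \<bullet> m + 2 * s * (m \<bullet> rot90 v) + s\<^sup>2 * r"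
    if "v \<bullet> v = r" for v
    unfolding power2_norm_eq_inner that[symmetric]
    by (simp add: inner_vec_def sum_2 power2_eq_square algebra_simps)
  have "s * (m \<bullet> rot90 e) = s * (m \<bullet> rot90 f)"
    using speed[OF ee] speed[OF ff] speeds(1) s t st by auto
  moreover have "s * (m \<bullet> rot90 e) = s * (m \<bullet> rot90 g)"
  proof -
    have "norm (m + s *\<^sub>R rot90 e) = norm (m + s *\<^sub>R rot90 g)"
      using speeds(2) unfolding pq by (simp add: s)
    then show ?thesis
      using speed[OF ee] speed[OF g] by auto
  qed
  moreover have "s * (m \<bullet> rot90 g) = - (s * (m \<bullet> rot90 e)) - s * (m \<bullet> rot90 f)"
    by (simp add: g_def inner_vec_def sum_2 algebra_simps)
  ultimately have sm: "s * (m \<bullet> rot90 e) = 0" "s * (m \<bullet> rot90 f) = 0"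
    by linarith+
  show ?thesis
  proof (cases "s = 0")
    case False
    then have me: "m \<bullet> rot90 e = 0" and mf: "m \<bullet> rot90 f = 0"
      using sm by auto
    \<comment> \<open>Cramer's rule for \<open>m\<close> in the basis \<open>e\<close>,
      \<open>f\<close>.\<close>
    have "k *\<^sub>R m = (m \<bullet> rot90 e) *\<^sub>R f - (m \<bullet> rot90 f) *\<^sub>R e"
      by (simp add: k_def vec_eq_iff forall_2 inner_vec_def sum_2 algebra_simps)
    then show ?thesis
      using me mf k by simp
  qed (simp add: s)
qed

lemma inner_has_zero_derivative_imp:
  fixes f g :: "real \<Rightarrow> 'a::real_inner"
  assumes "(f has_vector_derivative f') (at x)" "(g has_vector_derivative g') (at x)"
    and "\<And>y. f y \<bullet> g y = c"
  shows "f x \<bullet> g' + f' \<bullet> g x = 0"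
proof -
  have "((\<lambda>y. f y \<bullet> g y) has_vector_derivative (f x \<bullet> g' + f' \<bullet> g x)) (at x)"
    using assms(1,2) unfolding has_vector_derivative_def
    by (auto intro!: derivative_eq_intros simp: algebra_simps)
  moreover have "((\<lambda>y. f y \<bullet> g y) has_vector_derivative 0) (at x)"
    using assms(3) by simp
  ultimately show ?thesis
    using vector_derivative_unique_at by blast
qed

lemma zero_vector_derivative_imp_constant:
  fixes f :: "real \<Rightarrow> 'a::real_normed_vector"
  assumes "\<And>x. (f has_vector_derivative 0) (at x)"
  obtains c where "\<And>x. f x = c"
  using has_vector_derivative_zero_constant[of UNIV f] assms by auto

lemma continuous_two_valued:
  fixes h :: "real \<Rightarrow> real"
  assumes "continuous_on UNIV h" "\<And>x. h x = 0 \<or> h x = 1"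
  shows "(\<forall>x. h x = 0) \<or> (\<forall>x. h x = 1)"
proof -
  have "h constant_on UNIV"
    using assms by (intro continuous_finite_range_constant finite_subset[of "range h" "{0, 1}"]) auto
  then show ?thesis
    using assms(2) by (auto simp: constant_on_def)
qed

text \<open>A compact convex set is the convex hull of its frontier, so \<open>K\<close> lies in the
  closed ball. From an interior point \<open>p\<close>, the ray through a point \<open>q\<close> of
  the sphere meets the frontier, hence the sphere. A ray from inside the ball meets the sphere only
  once, so that frontier point is \<open>q\<close>.\<close>

lemma convex_frontier_subset_sphere_eq:
  fixes K :: "'a::euclidean_space set"
  assumes "compact K" "convex K" "interior K \<noteq> {}" "frontier K \<subseteq> sphere c r" "r > 0"
  shows "frontier K = sphere c r"
proof -
  obtain p where p: "p \<in> interior K"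
    using assms by auto
  have "K \<subseteq> cball c r"
  proof -
    have "K = convex hull frontier K"
      using Krein_Milman_frontier assms by blast
    also have "\<dots> \<subseteq> cball c r"
      using assms(4) by (intro hull_minimal) (auto simp: sphere_cball subset_iff)
    finally show ?thesis .
  qed
  then have pb: "p \<in> ball c r"
    using p interior_mono[of K "cball c r"] by auto
  have "q \<in> frontier K" if q: "q \<in> sphere c r" for q
  proof -
    have "q - p \<noteq> 0"
      using pb q by auto
    then obtain a where a: "0 < a" "p + a *\<^sub>R (q - p) \<in> frontier K"
      using ray_to_frontier[OF compact_imp_bounded[OF assms(1)] p] by blast
    have inside: "y \<in> ball c r" if "y \<in> open_segment p z" "z \<in> sphere c r" for y z
      using in_interior_closure_convex_segment[of "cball c r" p z] pb that by auto
    show ?thesis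
    proof (cases a "1 :: real" rule: linorder_cases)
      case less
      then have "p + a *\<^sub>R (q - p) \<in> open_segment p q"
        using a \<open>q - p \<noteq> 0\<close> by (auto simp: in_segment algebra_simps)
      then show ?thesis
        using inside[of _ q] q a assms(4) by fastforce
    next
      case equal
      then show ?thesis
        using a by simp
    next
      case greater
      \<comment> \<open>Now the roles are exchanged: \<open>q\<close> would lie strictly between
        \<open>p\<close> and the frontier point \<open>z\<close>.\<close>
      define z where "z = p + a *\<^sub>R (q - p)"
      have "q = (1 - 1 / a) *\<^sub>R p + (1 / a) *\<^sub>R z"
        using a by (simp add: z_def algebra_simps)
      moreover have "p \<noteq> z"
        using a \<open>q - p \<noteq> 0\<close> by (simp add: z_def)
      ultimately have "q \<in> open_segment p z"
        using greater by (auto simp: in_segment intro!: exI[of _ "1 / a"])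
      then show ?thesis
        using inside[of q z] q a assms(4) by (auto simp: z_def)
    qed
  qed
  then show ?thesis
    using assms(4) by auto
qed

theorem theorem5:
  fixes \<Gamma> :: "real \<Rightarrow> real ^ 2"
  assumes "bicycle_curve \<Gamma> (1 / 3)"
  shows "is_circle (range \<Gamma>)"
proof -
  define T :: real where "T = 2 * pi / 3"
  obtain d K where per: "\<And>x. \<Gamma> (x + 2 * pi) = \<Gamma> x" and smooth: "smooth_curve \<Gamma>"
    and unit: "\<And>x. norm (vector_derivative \<Gamma> (at x)) = 1"
    and inj: "inj_on \<Gamma> {0..<2 * pi}"
    and K: "compact K" "convex K" "interior K \<noteq> {}" "frontier K = range \<Gamma>"
    and dist: "\<And>x. dist (\<Gamma> (x + T)) (\<Gamma> x) = d"
    using assms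
    by (auto simp: bicycle_curve_def smooth_closed_convex_curve_def closed_curve_2pi_def
        arc_length_param_def convex_curve_def T_def)
  define v where "v x = vector_derivative \<Gamma> (at x)" for x
  have "iter_deriv 0 \<Gamma> differentiable_on UNIV" "iter_deriv 1 \<Gamma> differentiable_on UNIV"
    using smooth unfolding smooth_curve_def by blast+
  then have diff: "\<Gamma> differentiable at x" and contv: "continuous_on UNIV v" for x
    by (auto simp: iter_deriv_def v_def differentiable_on_def intro: differentiable_imp_continuous_on)
  have shift: "((\<lambda>y. \<Gamma> (y + a)) has_vector_derivative v (x + a)) (at x)" for x a
    using vector_derivative_works[THEN iffD1, OF diff[of "x + a"]]
      vector_diff_chain_at[of "\<lambda>y. y + a" 1 x \<Gamma>]
    by (force simp: o_def v_def intro!: derivative_eq_intros)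
  have per3: "\<Gamma> (x + T + T + T) = \<Gamma> x" for x
    using per[of x] by (simp add: T_def add.assoc)
  have pos: "d > 0"
  proof -
    have "\<Gamma> (0 + T) \<noteq> \<Gamma> 0"
      using inj_onD[OF inj, of "0 + T" 0] pi_gt_zero by (auto simp: T_def)
    then show ?thesis
      using dist[of 0] by (metis zero_less_dist_iff)
  qed
  \<comment> \<open>\<open>G\<close> is the centre of the triangle and \<open>m\<close> its
    velocity; \<open>E\<close> is the radius vector of the vertex at \<open>x\<close> and
    \<open>P\<close> its derivative.\<close>
  define G where "G x = (1 / 3) *\<^sub>R (\<Gamma> x + \<Gamma> (x + T) + \<Gamma> (x + T + T))" for x
  define m where "m x = (1 / 3) *\<^sub>R (v x + v (x + T) + v (x + T + T))" for x
  define E where "E x = \<Gamma> x - G x" for x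
  define P where "P x = v x - m x" for x
  have vT: "v (x + T + T + T) = v x" for x
  proof -
    have "((\<lambda>y. \<Gamma> (y + (T + T + T))) has_vector_derivative v (x + (T + T + T))) (at x)"
      by (rule shift)
    then have "(\<Gamma> has_vector_derivative v (x + T + T + T)) (at x)"
      using per3 by (simp add: add.assoc)
    then show ?thesis
      using vector_derivative_at v_def by metis
  qed
  \<comment> \<open>A shift by \<open>T\<close> permutes the three vertices cyclically.\<close>
  have GT: "G (x + T) = G x" and mT: "m (x + T) = m x" for x
    using per3[of x] vT[of x] by (simp_all add: G_def m_def add.commute add.left_commute)
  have dG: "(G has_vector_derivative m x) (at x)" for x
    using shift[of 0 x] shift[of T x] shift[of "T + T" x] unfolding G_def[abs_def] m_def
    by (auto intro!: derivative_eq_intros simp: add.assoc)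
  have dE: "(E has_vector_derivative P x) (at x)" for x
    unfolding E_def[abs_def] P_def
    using shift[of 0 x] dG[of x] by (auto intro!: derivative_eq_intros)
  have dET: "((\<lambda>y. E (y + T)) has_vector_derivative P (x + T)) (at x)" for x
    using shift[of T x] dG[of x] unfolding E_def P_def GT mT
    by (auto intro!: derivative_eq_intros)
  have sides: "(\<Gamma> (x + T) - \<Gamma> x) \<bullet> (\<Gamma> (x + T) - \<Gamma> x) = d\<^sup>2" for x
    using dist[of x] by (simp add: dist_norm power2_norm_eq_inner[symmetric])
  \<comment> \<open>An equilateral triangle of side \<open>d\<close> has squared circumradius
    \<open>d\<^sup>2 / 3\<close>, and its radius vectors meet at angles with cosine -1/2.\<close>
  have EE: "E x \<bullet> E x = d\<^sup>2 / 3" and EF: "E x \<bullet> E (x + T) = - (d\<^sup>2 / 3) / 2" for x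
    using sides[of x] sides[of "x + T"] sides[of "x + T + T"] unfolding E_def GT per3
    by (auto simp: G_def inner_vec_def sum_2 field_simps)
  have alternative: "P x = 0 \<or> m x = 0" for x
  proof (rule equal_speeds_imp_pure_translation_or_rotation)
    show "d\<^sup>2 / 3 > 0"
      using pos by simp
    show "E x \<bullet> E x = d\<^sup>2 / 3" "E (x + T) \<bullet> E (x + T) = d\<^sup>2 / 3"
      "E x \<bullet> E (x + T) = - (d\<^sup>2 / 3) / 2"
      using EE EF by blast+
    show "E x \<bullet> P x = 0" "E (x + T) \<bullet> P (x + T) = 0"
      using inner_has_zero_derivative_imp[OF dE dE EE]
      by (simp_all add: inner_commute)
    show "E (x + T) \<bullet> P x + E x \<bullet> P (x + T) = 0"
      using inner_has_zero_derivative_imp[OF dE dET EF] by (metis add.commute inner_commute)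
    \<comment> \<open>The relative velocities of the three vertices sum to zero.\<close>
    have "m x - P x - P (x + T) = v (x + T + T)"
      unfolding P_def mT by (simp add: m_def vec_eq_iff field_simps)
    then show "norm (m x + P x) = norm (m x - P x - P (x + T))"
      using unit by (simp add: P_def v_def)
    show "norm (m x + P x) = norm (m x + P (x + T))"
      using unit unfolding P_def mT by (simp add: v_def)
  qed
  have "norm (P x) = 0 \<or> norm (P x) = 1" for x
    using alternative[of x] unit[of x] by (auto simp: P_def v_def)
  moreover have "continuous_on UNIV (\<lambda>x. norm (P x))"
    unfolding P_def m_def
    by (intro continuous_intros contv continuous_on_compose2[OF contv]) auto
  ultimately consider "\<And>x. norm (P x) = 0" | "\<And>x. norm (P x) = 1"
    using continuous_two_valued[of "\<lambda>x. norm (P x)"] by blast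
  then show ?thesis
  proof cases
    case 1
    then have "v (x + T) = v x" for x
      using mT[of x] 1[of x] 1[of "x + T"] by (simp add: P_def)
    then have "((\<lambda>y. \<Gamma> (y + T) - \<Gamma> y) has_vector_derivative 0) (at x)" for x
      using shift[of T x] shift[of 0 x] by (auto intro!: derivative_eq_intros)
    then obtain w where w: "\<And>x. \<Gamma> (x + T) - \<Gamma> x = w"
      using zero_vector_derivative_imp_constant by blast
    \<comment> \<open>Three translations by \<open>w\<close> lead around the triangle and back to
      the start.\<close>
    have "3 *\<^sub>R w = (\<Gamma> (0 + T + T + T) - \<Gamma> (0 + T + T)) + (\<Gamma> (0 + T + T) - \<Gamma> (0 + T))
        + (\<Gamma> (0 + T) - \<Gamma> 0)"
      unfolding w by (simp add: vec_eq_iff)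
    also have "\<dots> = 0"
      using per3[of 0] by (simp add: algebra_simps)
    finally have "w = 0"
      by simp
    then show ?thesis
      using w[of 0] dist[of 0] pos by (simp add: dist_norm)
  next
    case 2
    then have "m x = 0" for x
      using alternative[of x] 2[of x] by (metis norm_zero zero_neq_one)
    then obtain c where c: "\<And>x. G x = c"
      using zero_vector_derivative_imp_constant[of G] dG by metis
    have "norm (\<Gamma> x - c) = sqrt (d\<^sup>2 / 3)" for x
      using EE[of x] by (simp add: E_def c norm_eq_sqrt_inner)
    then have "range \<Gamma> \<subseteq> sphere c (sqrt (d\<^sup>2 / 3))"
      by (auto simp: dist_norm norm_minus_commute)
    then have "range \<Gamma> = sphere c (sqrt (d\<^sup>2 / 3))"
      using convex_frontier_subset_sphere_eq[OF K(1-3)] K(4) pos by simp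
    then show ?thesis
      using pos unfolding is_circle_def by (intro exI[of _ c] exI[of _ "sqrt (d\<^sup>2 / 3)"]) simp
  qed
qed

end
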